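(* Let $\varphi\in\mathcal{L}_{pqT}$. Then $\varphi$ is strongly compositional, and for every lex model $\pi$, $\pi\models^*\varphi$ if and only if $\pi\models\varphi^{(\ge)}$. If $\varphi$ is non-strict then $\neg\varphi$ is compositional; if moreover $R_\varphi=S_\varphi$, then $\neg\varphi$ is strongly compositional, and for every lex model $\pi$, $\pi\models^*\neg\varphi$ if and only if either $\pi\models\neg\varphi$ or $V_\pi\cap S_\varphi=\emptyset$.
   Context: Let $V$ be a finite set of variables, each $X\in V$ having a finite nonempty domain $\underline{X}$; for $A\subseteq V$, $\underline{A}=\prod_{X\in A}\underline{X}$ is the set of assignments to $A$. An outcome is an element of $\underline{V}$; $\alpha(U)$ is the restriction of outcome $\alpha$ to $U\subseteq V$. A lex model $\pi$ is a (possibly empty) sequence $(Y_1,\ge_{Y_1}),\ldots,(Y_k,\ge_{Y_k})$ with pairwise distinct $Y_i\in V$ and each $\ge_{Y_i}$ a total order on $\underline{Y_i}$; $V_\pi=\{Y_1,\dots,Y_k\}$. $\alpha\succ_\pi\beta$ iff for some $i$, $\alpha(Y_j)=\beta(Y_j)$ for all $j<i$ and $\alpha(Y_i)>_{Y_i}\beta(Y_i)$ strictly; $\alpha\equiv_\pi\beta$ iff $\alpha(V_\pi)=\beta(V_\pi)$; $\alpha\succcurlyeq_\pi\beta$ iff $\alpha\succ_\pi\beta$ or $\alpha\equiv_\pi\beta$. For $\pi'=(Z_1,\ge_{Z_1}),\ldots,(Z_l,\ge_{Z_l})$, $\pi\circ\pi'$ is $\pi$ followed by $\pi'$ with all pairs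 whose variable lies in $V_\pi$ deleted. $\pi'$ extends $\pi$ if $\pi'\ne\pi$ and $\pi'$ begins with $\pi$; $\pi'\sqsupseteq\pi$ means extends or equals. Language $\mathcal{L}_{pqT}$: a statement $\varphi$ is given by a symbol $\rhd\in\{\ge,\gg,>\}$, pairwise disjoint subsets $U_\varphi$, $T_\varphi$, $R_\varphi\cup S_\varphi$ of $V$ (with $R_\varphi,S_\varphi$ possibly overlapping), and assignments $u_\varphi\in\underline{U_\varphi}$, $r_\varphi\in\underline{R_\varphi}$, $s_\varphi\in\underline{S_\varphi}$ with $r_\varphi(X)\neq s_\varphi(X)$ for all $X\in R_\varphi\cap S_\varphi$, and with every variable whose domain has one element belonging to $T_\varphi$; it is written $u_\varphi r_\varphi\rhd u_\varphi s_\varphi\ \parallel\ T_\varphi$. Let $\varphi^*$ be the set of pairs $(\alpha,\beta)$ of outcomes such that $\alpha$ extends $u_\varphi$ and $r_\varphi$, $\beta$ extends $u_\varphi$ and $s_\varphi$, and $\alpha(T_\varphi)=\beta(T_\varphi)$. $\varphi$ is non-strict if $\rhd$ is $\ge$, fully strict if $\gg$, weakly strict if $>$; $\varphi^{(\ge)}$ is the non-strict statement with the same data. Satisfaction: for non-strict $\varphi$, $\pi\models\varphi$ iff $\alpha\succcurlyeq_\pi\beta$ for all $(\alpha,\beta)\in\varphi^*$; for fully strict $\varphi$, iff $\alpha\succ_\pi\beta$ for all $(\alpha,\beta)\in\varphi^*$; for weakly strict $\varphi$, iff $\pi\models\varphi^{(\ge)}$ and $\alpha\succ_\pi\beta$ for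 some $(\alpha,\beta)\in\varphi^*$. For a statement $\varphi$, $\neg\varphi$ is the statement with $\pi\models\neg\varphi$ iff $\pi\not\models\varphi$. For any statement $\psi$: $\pi\models^*\psi$ iff some $\pi'\sqsupseteq\pi$ has $\pi'\models\psi$. $\psi$ is compositional if for all lex models $\pi,\pi'$, $\pi\models\psi$ and $\pi'\models\psi$ imply $\pi\circ\pi'\models\psi$; $\psi$ is strongly compositional if for all $\pi,\pi'$, $\pi\models^*\psi$ and $\pi'\models\psi$ imply $\pi\circ\pi'\models\psi$.
   Formalization: The first equivalence is asserted only if R∩S≠∅ when φ is fully strict and R∪S≠∅ when φ is weakly strict; the second only if S≠∅ or U∪T≠V. In the excluded cases φ (resp. ¬φ) has no model and the equivalence fails at the empty model. *)

theory Defs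
  imports "HOL-Library.FuncSet" "HOL-Library.Sublist"
begin

text \<open>
  Throughout, \<open>V\<close> is the set of variables and \<open>D X\<close> is the domain of the variable \<open>X\<close>. The
  assignments to \<open>A \<subseteq> V\<close> are the elements of \<open>PiE A D\<close>, and \<open>restrict \<alpha> U\<close> is \<open>\<alpha>(U)\<close>.
  A total order on \<open>D Y\<close> is a relation \<open>r\<close> with \<open>linear_order_on (D Y) r\<close>; a pair \<open>(a, b) \<in> r\<close>
  is read as \<open>a \<ge>\<^sub>Y b\<close>. The converse of a linear order is a linear order, so this choice of
  direction loses no order.
\<close>

type_synonym ('v, 'd) lex_model = "('v \<times> ('d \<times> 'd) set) list"

definition is_lex_model :: "'v set \<Rightarrow> ('v \<Rightarrow> 'd set) \<Rightarrow> ('v, 'd) lex_model \<Rightarrow> bool" where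
  "is_lex_model V D \<pi> \<longleftrightarrow>
     distinct (map fst \<pi>) \<and> (\<forall>(Y, r) \<in> set \<pi>. Y \<in> V \<and> linear_order_on (D Y) r)"

definition model_vars :: "('v, 'd) lex_model \<Rightarrow> 'v set" where
  "model_vars \<pi> = fst ` set \<pi>"

definition lex_gt :: "('v, 'd) lex_model \<Rightarrow> ('v \<Rightarrow> 'd) \<Rightarrow> ('v \<Rightarrow> 'd) \<Rightarrow> bool" where
  "lex_gt \<pi> \<alpha> \<beta> \<longleftrightarrow>
     (\<exists>i < length \<pi>.
        (\<forall>j < i. \<alpha> (fst (\<pi> ! j)) = \<beta> (fst (\<pi> ! j))) \<and>
        (\<alpha> (fst (\<pi> ! i)), \<beta> (fst (\<pi> ! i))) \<in> snd (\<pi> ! i) \<and>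
        \<alpha> (fst (\<pi> ! i)) \<noteq> \<beta> (fst (\<pi> ! i)))"

definition lex_equiv :: "('v, 'd) lex_model \<Rightarrow> ('v \<Rightarrow> 'd) \<Rightarrow> ('v \<Rightarrow> 'd) \<Rightarrow> bool" where
  "lex_equiv \<pi> \<alpha> \<beta> \<longleftrightarrow> restrict \<alpha> (model_vars \<pi>) = restrict \<beta> (model_vars \<pi>)"

definition lex_ge :: "('v, 'd) lex_model \<Rightarrow> ('v \<Rightarrow> 'd) \<Rightarrow> ('v \<Rightarrow> 'd) \<Rightarrow> bool" where
  "lex_ge \<pi> \<alpha> \<beta> \<longleftrightarrow> lex_gt \<pi> \<alpha> \<beta> \<or> lex_equiv \<pi> \<alpha> \<beta>"

definition lex_comp ::
  "('v, 'd) lex_model \<Rightarrow> ('v, 'd) lex_model \<Rightarrow> ('v, 'd) lex_model" where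
  "lex_comp \<pi> \<pi>' = \<pi> @ filter (\<lambda>p. fst p \<notin> model_vars \<pi>) \<pi>'"

datatype pref_symbol = NonStrict | FullyStrict | WeaklyStrict

text \<open>
  The statement \<open>u r \<rhd> u s \<parallel> T\<close>, with \<open>u\<close>, \<open>r\<close>, \<open>s\<close> assignments to \<open>st_U\<close>, \<open>st_R\<close>, \<open>st_S\<close>;
  the symbols \<open>\<ge>\<close>, \<open>\<gg>\<close>, \<open>>\<close> are \<open>NonStrict\<close>, \<open>FullyStrict\<close>, \<open>WeaklyStrict\<close> respectively.
\<close>

record ('v, 'd) pref_stmt =
  st_symbol :: pref_symbol
  st_U :: "'v set"
  st_T :: "'v set"
  st_R :: "'v set"
  st_S :: "'v set"
  st_u :: "'v \<Rightarrow> 'd"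
  st_r :: "'v \<Rightarrow> 'd"
  st_s :: "'v \<Rightarrow> 'd"

definition L_pqT :: "'v set \<Rightarrow> ('v \<Rightarrow> 'd set) \<Rightarrow> ('v, 'd) pref_stmt set" where
  "L_pqT V D = {\<phi>.
     st_U \<phi> \<subseteq> V \<and> st_T \<phi> \<subseteq> V \<and> st_R \<phi> \<subseteq> V \<and> st_S \<phi> \<subseteq> V \<and>
     st_U \<phi> \<inter> st_T \<phi> = {} \<and>
     st_U \<phi> \<inter> (st_R \<phi> \<union> st_S \<phi>) = {} \<and>
     st_T \<phi> \<inter> (st_R \<phi> \<union> st_S \<phi>) = {} \<and>
     st_u \<phi> \<in> PiE (st_U \<phi>) D \<and> st_r \<phi> \<in> PiE (st_R \<phi>) D \<and> st_s \<phi> \<in> PiE (st_S \<phi>) D \<and>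
     (\<forall>X \<in> st_R \<phi> \<inter> st_S \<phi>. st_r \<phi> X \<noteq> st_s \<phi> X) \<and>
     (\<forall>X \<in> V. card (D X) = 1 \<longrightarrow> X \<in> st_T \<phi>)}"

definition stmt_pairs ::
  "'v set \<Rightarrow> ('v \<Rightarrow> 'd set) \<Rightarrow> ('v, 'd) pref_stmt \<Rightarrow> (('v \<Rightarrow> 'd) \<times> ('v \<Rightarrow> 'd)) set" where
  "stmt_pairs V D \<phi> = {(\<alpha>, \<beta>).
     \<alpha> \<in> PiE V D \<and> \<beta> \<in> PiE V D \<and>
     restrict \<alpha> (st_U \<phi>) = st_u \<phi> \<and> restrict \<alpha> (st_R \<phi>) = st_r \<phi> \<and>
     restrict \<beta> (st_U \<phi>) = st_u \<phi> \<and> restrict \<beta> (st_S \<phi>) = st_s \<phi> \<and>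
     restrict \<alpha> (st_T \<phi>) = restrict \<beta> (st_T \<phi>)}"

definition nonstrict_version :: "('v, 'd) pref_stmt \<Rightarrow> ('v, 'd) pref_stmt" where
  "nonstrict_version \<phi> = \<phi>\<lparr>st_symbol := NonStrict\<rparr>"

definition sat ::
  "'v set \<Rightarrow> ('v \<Rightarrow> 'd set) \<Rightarrow> ('v, 'd) pref_stmt \<Rightarrow> ('v, 'd) lex_model \<Rightarrow> bool" where
  "sat V D \<phi> \<pi> \<longleftrightarrow> (case st_symbol \<phi> of
       NonStrict \<Rightarrow> \<forall>(\<alpha>, \<beta>) \<in> stmt_pairs V D \<phi>. lex_ge \<pi> \<alpha> \<beta>
     | FullyStrict \<Rightarrow> \<forall>(\<alpha>, \<beta>) \<in> stmt_pairs V D \<phi>. lex_gt \<pi> \<alpha> \<beta>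
     | WeaklyStrict \<Rightarrow>
         (\<forall>(\<alpha>, \<beta>) \<in> stmt_pairs V D \<phi>. lex_ge \<pi> \<alpha> \<beta>) \<and>
         (\<exists>(\<alpha>, \<beta>) \<in> stmt_pairs V D \<phi>. lex_gt \<pi> \<alpha> \<beta>))"

text \<open>
  The notions below apply to arbitrary statements, such as negations, of which only the models
  matter. So an arbitrary statement \<open>\<psi>\<close> is represented by its satisfaction predicate
  \<open>\<lambda>\<pi>. \<pi> \<Turnstile> \<psi>\<close>.
\<close>

type_synonym ('v, 'd) stmt_sem = "('v, 'd) lex_model \<Rightarrow> bool"

definition neg_stmt :: "('v, 'd) stmt_sem \<Rightarrow> ('v, 'd) stmt_sem" where
  "neg_stmt \<psi> = (\<lambda>\<pi>. \<not> \<psi> \<pi>)"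

definition sat_star ::
  "'v set \<Rightarrow> ('v \<Rightarrow> 'd set) \<Rightarrow> ('v, 'd) stmt_sem \<Rightarrow> ('v, 'd) lex_model \<Rightarrow> bool" where
  "sat_star V D \<psi> \<pi> \<longleftrightarrow> (\<exists>\<pi>'. is_lex_model V D \<pi>' \<and> prefix \<pi> \<pi>' \<and> \<psi> \<pi>')"

definition compositional :: "'v set \<Rightarrow> ('v \<Rightarrow> 'd set) \<Rightarrow> ('v, 'd) stmt_sem \<Rightarrow> bool" where
  "compositional V D \<psi> \<longleftrightarrow>
     (\<forall>\<pi> \<pi>'. is_lex_model V D \<pi> \<and> is_lex_model V D \<pi>' \<and> \<psi> \<pi> \<and> \<psi> \<pi>' \<longrightarrow> \<psi> (lex_comp \<pi> \<pi>'))"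

definition strongly_compositional ::
  "'v set \<Rightarrow> ('v \<Rightarrow> 'd set) \<Rightarrow> ('v, 'd) stmt_sem \<Rightarrow> bool" where
  "strongly_compositional V D \<psi> \<longleftrightarrow>
     (\<forall>\<pi> \<pi>'. is_lex_model V D \<pi> \<and> is_lex_model V D \<pi>' \<and> sat_star V D \<psi> \<pi> \<and> \<psi> \<pi>' \<longrightarrow>
        \<psi> (lex_comp \<pi> \<pi>'))"

text \<open>
  Some statements have no model at all, although their non-strict version holds in the empty
  model: a fully strict \<open>\<phi>\<close> with \<open>R\<^sub>\<phi> \<inter> S\<^sub>\<phi> = {}\<close>, because then \<open>\<phi>\<^sup>*\<close> contains a pair \<open>(\<alpha>, \<alpha>)\<close>, and a
  weakly strict \<open>\<phi>\<close> with \<open>R\<^sub>\<phi> \<union> S\<^sub>\<phi> = {}\<close>, because then \<open>\<phi>\<^sup>*\<close> is symmetric. Likewise \<open>\<not>\<phi>\<close> has no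
  model if \<open>\<phi>\<close> is non-strict, \<open>R\<^sub>\<phi> = S\<^sub>\<phi> = {}\<close> and \<open>U\<^sub>\<phi> \<union> T\<^sub>\<phi> = V\<close>, because then \<open>\<phi>\<^sup>*\<close> only contains
  pairs \<open>(\<alpha>, \<alpha>)\<close>. These are exactly the statements for which the characterisation of \<open>\<Turnstile>\<^sup>*\<close> by
  the non-strict version, respectively by \<open>V\<^sub>\<pi> \<inter> S\<^sub>\<phi> = {}\<close>, fails.
\<close>

end

theory Submission
  imports Defs
begin

text \<open>
  Since \<open>\<phi>\<^sup>*\<close> is a product over the variables \<open>X\<close> of sets \<open>P X\<close> of pairs of values, \<open>\<phi>\<close> can be
  decided by walking through a lex model: the non-strict version holds iff \<open>P Y\<close> is contained in
  the order of each variable \<open>Y\<close>, up to and including the first \<open>Y\<close> whose \<open>P Y\<close> misses the diagonal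
  (that is, \<open>Y \<in> R \<inter> S\<close>), after which every pair is already decided. Given the non-strict version,
  the fully strict one says that such a \<open>Y\<close> occurs, and the weakly strict one that some \<open>Y\<close> with
  \<open>P Y\<close> not contained in the diagonal (that is, \<open>Y \<notin> U \<union> T\<close>) occurs. The latter two conditions
  are monotone in the set of variables of the model, and the first one passes to prefixes and
  compositions. If \<open>R = S\<close>, a model of the non-strict version in which no such first \<open>Y\<close> occurs only
  has variables in \<open>U \<union> T\<close>, where \<open>P Y\<close> lies in the diagonal, so deleting these variables from
  another model does not affect whether it satisfies \<open>\<phi>\<close>.
\<close>

section \<open>Lexicographic comparison\<close>

lemma model_vars_simps [simp]:
  "model_vars [] = {}"
  "model_vars (p # \<pi>) = insert (fst p) (model_vars \<pi>)"
  "model_vars (\<pi> @ \<pi>') = model_vars \<pi> \<union> model_vars \<pi>'"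
  by (auto simp: model_vars_def)

lemma model_vars_lex_comp: "model_vars (lex_comp \<pi> \<pi>') = model_vars \<pi> \<union> model_vars \<pi>'"
  by (auto simp: lex_comp_def model_vars_def)

lemma is_lex_model_Cons [simp]:
  "is_lex_model V D ((Y, r) # \<pi>) \<longleftrightarrow>
     Y \<in> V \<and> linear_order_on (D Y) r \<and> Y \<notin> model_vars \<pi> \<and> is_lex_model V D \<pi>"
  by (auto simp: is_lex_model_def model_vars_def)

lemma is_lex_model_snoc:
  assumes "is_lex_model V D \<pi>" "X \<in> V" "linear_order_on (D X) r" "X \<notin> model_vars \<pi>"
  shows "is_lex_model V D (\<pi> @ [(X, r)])"
  using assms by (auto simp: is_lex_model_def model_vars_def)

lemma is_lex_model_lex_comp:
  assumes "is_lex_model V D \<pi>" "is_lex_model V D \<pi>'"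
  shows "is_lex_model V D (lex_comp \<pi> \<pi>')"
proof -
  have "B \<inter> fst ` {p \<in> A. fst p \<notin> B} = {}" for A :: "('a \<times> ('b \<times> 'b) set) set" and B
    by auto
  then show ?thesis
    using assms by (simp add: is_lex_model_def lex_comp_def model_vars_def distinct_map_filter ball_Un)
qed

lemma model_vars_subset: "is_lex_model V D \<pi> \<Longrightarrow> model_vars \<pi> \<subseteq> V"
  by (auto simp: is_lex_model_def model_vars_def)

lemma lex_gt_Cons [simp]:
  "lex_gt ((Y, r) # \<pi>) \<alpha> \<beta> \<longleftrightarrow>
     (if \<alpha> Y = \<beta> Y then lex_gt \<pi> \<alpha> \<beta> else (\<alpha> Y, \<beta> Y) \<in> r)"
  unfolding lex_gt_def length_Cons Ex_less_Suc2 All_less_Suc2 by auto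

lemma lex_equiv_iff: "lex_equiv \<pi> \<alpha> \<beta> \<longleftrightarrow> (\<forall>Y \<in> model_vars \<pi>. \<alpha> Y = \<beta> Y)"
  by (auto simp: lex_equiv_def restrict_def fun_eq_iff)

lemma lex_ge_Nil [simp]: "lex_ge [] \<alpha> \<beta>"
  by (simp add: lex_ge_def lex_equiv_iff)

lemma lex_ge_Cons [simp]:
  "lex_ge ((Y, r) # \<pi>) \<alpha> \<beta> \<longleftrightarrow>
     (if \<alpha> Y = \<beta> Y then lex_ge \<pi> \<alpha> \<beta> else (\<alpha> Y, \<beta> Y) \<in> r)"
  by (auto simp: lex_ge_def lex_equiv_iff)

lemma lex_gt_not_equiv: "lex_gt \<pi> \<alpha> \<beta> \<Longrightarrow> \<not> lex_equiv \<pi> \<alpha> \<beta>"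
  by (force simp: lex_gt_def lex_equiv_iff model_vars_def)

lemma lex_gt_iff: "lex_gt \<pi> \<alpha> \<beta> \<longleftrightarrow> lex_ge \<pi> \<alpha> \<beta> \<and> \<not> lex_equiv \<pi> \<alpha> \<beta>"
  using lex_gt_not_equiv by (auto simp: lex_ge_def)

text \<open>This lets the values at the head variable of a model be overwritten without disturbing
  the comparison in its tail.\<close>

lemma lex_ge_update:
  "Y \<notin> model_vars \<pi> \<Longrightarrow> lex_ge \<pi> (\<alpha>(Y := c)) (\<beta>(Y := d)) \<longleftrightarrow> lex_ge \<pi> \<alpha> \<beta>"
  by (induction \<pi>) (auto simp del: fun_upd_apply simp: fun_upd_other)

lemma linear_order_on_refl: "linear_order_on A r \<Longrightarrow> x \<in> A \<Longrightarrow> (x, x) \<in> r"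
  by (auto simp: order_on_defs refl_on_def)

lemma linear_order_on_antisym:
  "linear_order_on A r \<Longrightarrow> (x, y) \<in> r \<Longrightarrow> (y, x) \<in> r \<Longrightarrow> x = y"
  by (auto simp: order_on_defs antisym_def)

lemma linear_order_with_top:
  assumes "finite A" "a \<in> A"
  obtains r where "linear_order_on A r" "{a} \<times> A \<subseteq> r"
proof -
  obtain f :: "'a \<Rightarrow> nat" where f: "inj_on f A"
    using assms(1) finite_imp_inj_to_nat_seg by metis
  \<comment> \<open>Smaller rank means greater element: \<open>a\<close> receives rank 0, and
    \<open>Suc\<close> keeps every other element away from it.\<close>
  define k where "k = (\<lambda>x. if x = a then 0 else Suc (f x))"
  have k: "inj_on k A"
    using f by (auto simp: inj_on_def k_def)
  let ?r = "{(x, y). x \<in> A \<and> y \<in> A \<and> k x \<le> k y}"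
  have "linear_order_on A ?r"
    using k by (auto simp: order_on_defs refl_on_def trans_def antisym_def total_on_def inj_on_def)
  moreover have "{a} \<times> A \<subseteq> ?r"
    using assms(2) by (auto simp: k_def)
  ultimately show ?thesis by (rule that)
qed

section \<open>Models of a product of comparisons\<close>

definition product_pairs ::
  "'v set \<Rightarrow> ('v \<Rightarrow> 'd set) \<Rightarrow> ('v \<Rightarrow> ('d \<times> 'd) set) \<Rightarrow> (('v \<Rightarrow> 'd) \<times> ('v \<Rightarrow> 'd)) set" where
  "product_pairs V D P =
     {(\<alpha>, \<beta>). \<alpha> \<in> PiE V D \<and> \<beta> \<in> PiE V D \<and> (\<forall>X \<in> V. (\<alpha> X, \<beta> X) \<in> P X)}"

fun conforms :: "('v \<Rightarrow> ('d \<times> 'd) set) \<Rightarrow> ('v, 'd) lex_model \<Rightarrow> bool" where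
  "conforms P [] \<longleftrightarrow> True"
| "conforms P ((Y, r) # \<pi>) \<longleftrightarrow> P Y \<subseteq> r \<and> (P Y \<inter> Id = {} \<or> conforms P \<pi>)"

text \<open>At such a variable no pair of the product agrees, so a model is decided there at the
  latest.\<close>

definition decisive :: "('v \<Rightarrow> ('d \<times> 'd) set) \<Rightarrow> 'v set" where
  "decisive P = {X. P X \<inter> Id = {}}"

definition nontrivial :: "('v \<Rightarrow> ('d \<times> 'd) set) \<Rightarrow> 'v set" where
  "nontrivial P = {X. \<not> P X \<subseteq> Id}"

lemma product_pairs_choice:
  assumes "\<And>X. X \<in> V \<Longrightarrow> P X \<subseteq> D X \<times> D X" and "\<And>X. X \<in> V \<Longrightarrow> f X \<in> P X"
  shows "(restrict (fst \<circ> f) V, restrict (snd \<circ> f) V) \<in> product_pairs V D P"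
  using assms by (fastforce simp: product_pairs_def PiE_iff mem_Times_iff)

text \<open>The coordinates of a product are independent: the value at \<open>Y\<close> is
  prescribed, and the others are picked from the nonempty sets \<open>P X\<close>.\<close>

lemma product_pairs_with_value:
  assumes P: "\<And>X. X \<in> V \<Longrightarrow> P X \<noteq> {}" "\<And>X. X \<in> V \<Longrightarrow> P X \<subseteq> D X \<times> D X"
    and "Y \<in> V" "(a, b) \<in> P Y"
  obtains \<alpha> \<beta> where "(\<alpha>, \<beta>) \<in> product_pairs V D P" "\<alpha> Y = a" "\<beta> Y = b"
proof -
  define f where "f = (\<lambda>X. if X = Y then (a, b) else (SOME p. p \<in> P X))"
  have "f X \<in> P X" if "X \<in> V" for X
    using P(1)[OF that] assms(4) by (auto simp: f_def some_in_eq)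
  from product_pairs_choice[of V P D f, OF P(2) this] show ?thesis
    by (rule that) (use \<open>Y \<in> V\<close> in \<open>auto simp: f_def\<close>)
qed

text \<open>Independence of coordinates drives the induction. Every pair in \<open>P Y\<close> is
  realised by some pair of outcomes, which forces \<open>P Y \<subseteq> r\<close>; and if
  \<open>P Y\<close> meets the diagonal, every pair of outcomes can be made to agree at
  \<open>Y\<close>, so that the tail must settle it.\<close>

lemma all_lex_ge_iff_conforms:
  assumes P: "\<And>X. X \<in> V \<Longrightarrow> P X \<noteq> {}" "\<And>X. X \<in> V \<Longrightarrow> P X \<subseteq> D X \<times> D X"
    and "is_lex_model V D \<pi>"
  shows "(\<forall>(\<alpha>, \<beta>) \<in> product_pairs V D P. lex_ge \<pi> \<alpha> \<beta>) \<longleftrightarrow> conforms P \<pi>"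
  using assms(3)
proof (induction \<pi>)
  case Nil
  show ?case by simp
next
  case (Cons p \<pi>)
  obtain Y r where p: "p = (Y, r)" by (cases p)
  have Y: "Y \<in> V" "linear_order_on (D Y) r" "Y \<notin> model_vars \<pi>" "is_lex_model V D \<pi>"
    using Cons.prems by (auto simp: p)
  note IH = Cons.IH[OF Y(4)]
  show ?case
  proof
    assume ge: "\<forall>(\<alpha>, \<beta>) \<in> product_pairs V D P. lex_ge (p # \<pi>) \<alpha> \<beta>"
    have "P Y \<subseteq> r"
    proof (clarify)
      fix a b assume ab: "(a, b) \<in> P Y"
      obtain \<alpha> \<beta> where "(\<alpha>, \<beta>) \<in> product_pairs V D P" "\<alpha> Y = a" "\<beta> Y = b"
        using product_pairs_with_value[of V P D, OF P Y(1) ab] .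
      \<comment> \<open>If \<open>a = b\<close>, the comparison passes over \<open>Y\<close> and
        says nothing about \<open>r\<close>; reflexivity on \<open>D Y\<close> covers this
        case.\<close>
      moreover have "a \<in> D Y" using P(2)[OF Y(1)] ab by auto
      ultimately show "(a, b) \<in> r"
        using ge linear_order_on_refl[OF Y(2)] by (fastforce simp: p split: if_splits)
    qed
    moreover have "conforms P \<pi>" if c: "(c, c) \<in> P Y" for c
    proof (unfold IH[symmetric], clarify)
      fix \<alpha> \<beta> assume "(\<alpha>, \<beta>) \<in> product_pairs V D P"
      then have "(\<alpha>(Y := c), \<beta>(Y := c)) \<in> product_pairs V D P"
        using c P(2)[OF Y(1)] Y(1) by (auto simp: product_pairs_def PiE_iff extensional_def)
      with ge have "lex_ge (p # \<pi>) (\<alpha>(Y := c)) (\<beta>(Y := c))" by blast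
      then show "lex_ge \<pi> \<alpha> \<beta>"
        using lex_ge_update[OF Y(3)] by (simp add: p)
    qed
    ultimately show "conforms P (p # \<pi>)" by (auto simp: p)
  next
    assume r: "conforms P (p # \<pi>)"
    show "\<forall>(\<alpha>, \<beta>) \<in> product_pairs V D P. lex_ge (p # \<pi>) \<alpha> \<beta>"
    proof clarify
      fix \<alpha> \<beta> assume ab: "(\<alpha>, \<beta>) \<in> product_pairs V D P"
      then have "(\<alpha> Y, \<beta> Y) \<in> P Y" using Y(1) by (auto simp: product_pairs_def)
      with r ab IH show "lex_ge (p # \<pi>) \<alpha> \<beta>" by (auto simp: p)
    qed
  qed
qed

lemma all_not_lex_equiv_iff:
  assumes P: "\<And>X. X \<in> V \<Longrightarrow> P X \<noteq> {}" "\<And>X. X \<in> V \<Longrightarrow> P X \<subseteq> D X \<times> D X"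
    and "model_vars \<pi> \<subseteq> V"
  shows "(\<forall>(\<alpha>, \<beta>) \<in> product_pairs V D P. \<not> lex_equiv \<pi> \<alpha> \<beta>) \<longleftrightarrow> model_vars \<pi> \<inter> decisive P \<noteq> {}"
proof
  assume neq: "\<forall>(\<alpha>, \<beta>) \<in> product_pairs V D P. \<not> lex_equiv \<pi> \<alpha> \<beta>"
  show "model_vars \<pi> \<inter> decisive P \<noteq> {}"
  proof
    assume dec: "model_vars \<pi> \<inter> decisive P = {}"
    \<comment> \<open>A diagonal pair at each variable of the model yields two outcomes that the
      model cannot tell apart.\<close>
    define f where "f = (\<lambda>X. SOME p. p \<in> P X \<and> (X \<in> model_vars \<pi> \<longrightarrow> p \<in> Id))"
    have f: "f X \<in> P X \<and> (X \<in> model_vars \<pi> \<longrightarrow> f X \<in> Id)" if "X \<in> V" for X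
      unfolding f_def by (rule someI_ex) (use P(1)[OF that] dec in \<open>auto simp: decisive_def\<close>)
    then have "(restrict (fst \<circ> f) V, restrict (snd \<circ> f) V) \<in> product_pairs V D P"
      by (intro product_pairs_choice P(2)) auto
    moreover have "lex_equiv \<pi> (restrict (fst \<circ> f) V) (restrict (snd \<circ> f) V)"
      using f assms(3) by (fastforce simp: lex_equiv_iff)
    ultimately show False using neq by blast
  qed
next
  assume "model_vars \<pi> \<inter> decisive P \<noteq> {}"
  then show "\<forall>(\<alpha>, \<beta>) \<in> product_pairs V D P. \<not> lex_equiv \<pi> \<alpha> \<beta>"
    using assms(3) by (fastforce simp: lex_equiv_iff product_pairs_def decisive_def)
qed

lemma ex_not_lex_equiv_iff:
  assumes P: "\<And>X. X \<in> V \<Longrightarrow> P X \<noteq> {}" "\<And>X. X \<in> V \<Longrightarrow> P X \<subseteq> D X \<times> D X"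
    and "model_vars \<pi> \<subseteq> V"
  shows "(\<exists>(\<alpha>, \<beta>) \<in> product_pairs V D P. \<not> lex_equiv \<pi> \<alpha> \<beta>) \<longleftrightarrow> model_vars \<pi> \<inter> nontrivial P \<noteq> {}"
proof
  assume "\<exists>(\<alpha>, \<beta>) \<in> product_pairs V D P. \<not> lex_equiv \<pi> \<alpha> \<beta>"
  then show "model_vars \<pi> \<inter> nontrivial P \<noteq> {}"
    using assms(3) by (fastforce simp: lex_equiv_iff product_pairs_def nontrivial_def)
next
  assume "model_vars \<pi> \<inter> nontrivial P \<noteq> {}"
  then obtain Y a b where Y: "Y \<in> model_vars \<pi>" "(a, b) \<in> P Y" "a \<noteq> b"
    by (auto simp: nontrivial_def)
  then have "Y \<in> V" using assms(3) by blast
  with Y obtain \<alpha> \<beta> where "(\<alpha>, \<beta>) \<in> product_pairs V D P" "\<alpha> Y = a" "\<beta> Y = b"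
    using product_pairs_with_value[of V P D, OF P] by metis
  with Y show "\<exists>(\<alpha>, \<beta>) \<in> product_pairs V D P. \<not> lex_equiv \<pi> \<alpha> \<beta>"
    by (auto simp: lex_equiv_iff)
qed

text \<open>The scan reaches the suffix only if it meets no decisive variable before. In particular,
  conformity passes to prefixes.\<close>

lemma conforms_append:
  "conforms P (\<pi> @ \<pi>') \<longleftrightarrow>
     conforms P \<pi> \<and> (model_vars \<pi> \<inter> decisive P \<noteq> {} \<or> conforms P \<pi>')"
  by (induction P \<pi> rule: conforms.induct) (auto simp: decisive_def)

text \<open>Since all decisive variables are kept, the scan of the shorter list does not run past
  the point where the original scan stopped.\<close>

lemma conforms_filter:
  assumes "conforms P \<pi>" "\<And>p. p \<in> set \<pi> \<Longrightarrow> fst p \<in> decisive P \<Longrightarrow> Q p"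
  shows "conforms P (filter Q \<pi>)"
  using assms by (induction P \<pi> rule: conforms.induct) (auto simp: decisive_def)

text \<open>Either \<open>\<pi>\<close> contains a decisive variable and the scan never leaves it,
  or all variables deleted from \<open>\<pi>'\<close> are not decisive.\<close>

lemma conforms_lex_comp:
  assumes "conforms P \<pi>" "conforms P \<pi>'"
  shows "conforms P (lex_comp \<pi> \<pi>')"
  using assms by (auto simp: lex_comp_def conforms_append intro!: conforms_filter)

text \<open>Putting back a variable with \<open>P Y \<subseteq> Id\<close> adds only a requirement
  that holds by reflexivity of its order.\<close>

lemma conforms_of_filter:
  assumes "conforms P (filter Q \<pi>)" "is_lex_model V D \<pi>"
    and "\<And>X. X \<in> V \<Longrightarrow> P X \<subseteq> D X \<times> D X"
    and "\<And>p. p \<in> set \<pi> \<Longrightarrow> \<not> Q p \<Longrightarrow> fst p \<notin> nontrivial P"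
  shows "conforms P \<pi>"
  using assms
proof (induction \<pi>)
  case (Cons p \<pi>)
  obtain Y r where p: "p = (Y, r)" by (cases p)
  have "conforms P \<pi>" if "conforms P (filter Q \<pi>)"
    using Cons.IH[OF that] Cons.prems by (simp add: p)
  moreover have "P Y \<subseteq> r" if "\<not> Q p"
  proof -
    have "P Y \<subseteq> Id"
      using that Cons.prems(4)[of p] by (simp add: p nontrivial_def)
    moreover have "P Y \<subseteq> D Y \<times> D Y"
      using Cons.prems(2,3) by (simp add: p)
    ultimately show ?thesis
      using linear_order_on_refl[of "D Y" r] Cons.prems(2) by (fastforce simp: p)
  qed
  ultimately show ?case
    using Cons.prems(1) by (auto simp: p split: if_splits)
qed simp

lemma conforms_snoc: "conforms P \<pi> \<Longrightarrow> P X \<subseteq> r \<Longrightarrow> conforms P (\<pi> @ [(X, r)])"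
  by (simp add: conforms_append)

text \<open>Without decisive variables the scan reaches \<open>X\<close>, so its order contains
  \<open>P X\<close>; the whole square would violate antisymmetry at \<open>a\<close> and
  \<open>b\<close>.\<close>

lemma conforms_not_whole_square:
  assumes "conforms P \<pi>" "is_lex_model V D \<pi>" "model_vars \<pi> \<inter> decisive P = {}"
    and "X \<in> model_vars \<pi>" "a \<in> D X" "b \<in> D X" "a \<noteq> b"
  shows "P X \<noteq> D X \<times> D X"
  using assms
proof (induction P \<pi> rule: conforms.induct)
  case (2 P Y r \<pi>)
  show ?case
  proof (cases "X = Y")
    case True
    then show ?thesis
      using 2(2-) linear_order_on_antisym[of "D Y" r a b] by auto
  next
    case False
    then show ?thesis using 2 by (auto simp: decisive_def)
  qed
qed simp

section \<open>Preference statements as products\<close>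

text \<open>The factor of \<open>\<phi>\<^sup>*\<close> at the variable \<open>X\<close>.\<close>

definition value_pairs :: "('v \<Rightarrow> 'd set) \<Rightarrow> ('v, 'd) pref_stmt \<Rightarrow> 'v \<Rightarrow> ('d \<times> 'd) set" where
  "value_pairs D \<phi> X = {(a, b). a \<in> D X \<and> b \<in> D X \<and>
     (X \<in> st_U \<phi> \<longrightarrow> a = st_u \<phi> X \<and> b = st_u \<phi> X) \<and>
     (X \<in> st_R \<phi> \<longrightarrow> a = st_r \<phi> X) \<and> (X \<in> st_S \<phi> \<longrightarrow> b = st_s \<phi> X) \<and>
     (X \<in> st_T \<phi> \<longrightarrow> a = b)}"

lemma restrict_eq_PiE_iff:
  "f \<in> PiE A D \<Longrightarrow> restrict \<alpha> A = f \<longleftrightarrow> (\<forall>X \<in> A. \<alpha> X = f X)"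
  by (auto simp: PiE_iff extensional_def restrict_def fun_eq_iff)

lemma stmt_pairs_eq_product:
  assumes "\<phi> \<in> L_pqT V D"
  shows "stmt_pairs V D \<phi> = product_pairs V D (value_pairs D \<phi>)"
proof -
  have sub: "st_U \<phi> \<subseteq> V" "st_R \<phi> \<subseteq> V" "st_S \<phi> \<subseteq> V" "st_T \<phi> \<subseteq> V"
    and mem: "st_u \<phi> \<in> PiE (st_U \<phi>) D" "st_r \<phi> \<in> PiE (st_R \<phi>) D" "st_s \<phi> \<in> PiE (st_S \<phi>) D"
    using assms by (auto simp: L_pqT_def)
  have T: "restrict \<alpha> (st_T \<phi>) = restrict \<beta> (st_T \<phi>) \<longleftrightarrow> (\<forall>X \<in> st_T \<phi>. \<alpha> X = \<beta> X)"
    for \<alpha> \<beta> :: "'a \<Rightarrow> 'b"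
    by (auto simp: restrict_def fun_eq_iff)
  show ?thesis
    unfolding stmt_pairs_def product_pairs_def value_pairs_def
      restrict_eq_PiE_iff[OF mem(1)] restrict_eq_PiE_iff[OF mem(2)] restrict_eq_PiE_iff[OF mem(3)] T
    using sub by (auto simp: PiE_iff)
qed

lemma value_pairs_subset: "value_pairs D \<phi> X \<subseteq> D X \<times> D X"
  by (auto simp: value_pairs_def)

lemma value_pairs_nonempty:
  assumes "\<phi> \<in> L_pqT V D" "D X \<noteq> {}"
  shows "value_pairs D \<phi> X \<noteq> {}"
proof -
  obtain d where "d \<in> D X" using assms(2) by blast
  \<comment> \<open>Both components share the default \<open>d\<close>, so they agree on
    \<open>T\<close>, which is disjoint from \<open>U\<close>, \<open>R\<close> and
    \<open>S\<close>.\<close>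
  define a where "a = (if X \<in> st_U \<phi> then st_u \<phi> X else if X \<in> st_R \<phi> then st_r \<phi> X else d)"
  define b where "b = (if X \<in> st_U \<phi> then st_u \<phi> X else if X \<in> st_S \<phi> then st_s \<phi> X else d)"
  have "(a, b) \<in> value_pairs D \<phi> X"
    using assms(1) \<open>d \<in> D X\<close>
    by (auto simp: value_pairs_def L_pqT_def PiE_iff a_def b_def)
  then show ?thesis by blast
qed

text \<open>On \<open>R \<inter> S\<close> the two components are forced to different values;
  elsewhere at most one value is forced, and both components can take it.\<close>

lemma decisive_value_pairs_iff:
  assumes "\<phi> \<in> L_pqT V D" "X \<in> V" "D X \<noteq> {}"
  shows "X \<in> decisive (value_pairs D \<phi>) \<longleftrightarrow> X \<in> st_R \<phi> \<inter> st_S \<phi>"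
proof
  show "X \<in> st_R \<phi> \<inter> st_S \<phi> \<Longrightarrow> X \<in> decisive (value_pairs D \<phi>)"
    using assms(1) by (auto simp: decisive_def value_pairs_def L_pqT_def)
next
  assume dec: "X \<in> decisive (value_pairs D \<phi>)"
  obtain d where d: "d \<in> D X" using assms(3) by blast
  define a where "a = (if X \<in> st_U \<phi> then st_u \<phi> X else if X \<in> st_R \<phi> then st_r \<phi> X
    else if X \<in> st_S \<phi> then st_s \<phi> X else d)"
  have "(a, a) \<in> value_pairs D \<phi> X" if "X \<notin> st_R \<phi> \<inter> st_S \<phi>"
    using assms(1) d that by (auto simp: value_pairs_def L_pqT_def PiE_iff a_def)
  then show "X \<in> st_R \<phi> \<inter> st_S \<phi>" using dec by (auto simp: decisive_def)
qed

text \<open>One-element domains occur only in \<open>T\<close>, so outside \<open>T\<close> any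
  given value can be avoided.\<close>

lemma two_values:
  assumes "\<phi> \<in> L_pqT V D" "X \<in> V" "D X \<noteq> {}" "X \<notin> st_T \<phi>"
  obtains d where "d \<in> D X" "d \<noteq> c"
proof -
  have "card (D X) \<noteq> 1" using assms by (auto simp: L_pqT_def)
  then have "D X \<noteq> {c}" by auto
  then show ?thesis using that assms(3) by blast
qed

lemma nontrivial_value_pairs_iff:
  assumes "\<phi> \<in> L_pqT V D" "X \<in> V" "D X \<noteq> {}"
  shows "X \<in> nontrivial (value_pairs D \<phi>) \<longleftrightarrow> X \<notin> st_U \<phi> \<union> st_T \<phi>"
proof
  show "X \<in> nontrivial (value_pairs D \<phi>) \<Longrightarrow> X \<notin> st_U \<phi> \<union> st_T \<phi>"
    by (auto simp: nontrivial_def value_pairs_def)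
next
  assume X: "X \<notin> st_U \<phi> \<union> st_T \<phi>"
  \<comment> \<open>An admissible second component. Outside \<open>R\<close> the first component is
    free and can avoid \<open>b\<close>; inside \<open>R\<close> it is fixed, and the second one
    differs from it by choice, or by \<open>r \<noteq> s\<close> on
    \<open>R \<inter> S\<close>.\<close>
  define b where "b = (if X \<in> st_S \<phi> then st_s \<phi> X else SOME d. d \<in> D X)"
  have b: "b \<in> D X"
    using assms by (auto simp: b_def L_pqT_def PiE_iff some_in_eq)
  obtain d where d: "d \<in> D X" "d \<noteq> b" using two_values[OF assms] X by auto
  obtain e where e: "e \<in> D X" "e \<noteq> st_r \<phi> X" using two_values[OF assms] X by auto
  have "\<exists>p \<in> value_pairs D \<phi> X. p \<notin> Id"
  proof (cases "X \<in> st_R \<phi>")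
    case False
    then have "(d, b) \<in> value_pairs D \<phi> X" using X b d by (auto simp: value_pairs_def b_def)
    with d show ?thesis by auto
  next
    case True
    define c where "c = (if X \<in> st_S \<phi> then b else e)"
    have "(st_r \<phi> X, c) \<in> value_pairs D \<phi> X" "st_r \<phi> X \<noteq> c"
      using True X b e assms(1) by (auto simp: value_pairs_def b_def c_def L_pqT_def PiE_iff)
    then show ?thesis by auto
  qed
  then show "X \<in> nontrivial (value_pairs D \<phi>)" by (auto simp: nontrivial_def)
qed

text \<open>On \<open>R\<close> the first component is constant, so that value is placed on top.
  Otherwise the second component is constant and is placed at the bottom, by taking the converse of
  an order with it on top.\<close>

lemma linear_order_above_value_pairs:
  assumes "finite (D X)" "\<phi> \<in> L_pqT V D" "X \<in> st_R \<phi> \<union> st_S \<phi>"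
  obtains r where "linear_order_on (D X) r" "value_pairs D \<phi> X \<subseteq> r"
proof (cases "X \<in> st_R \<phi>")
  case True
  then have "st_r \<phi> X \<in> D X" using assms(2) by (auto simp: L_pqT_def PiE_iff)
  then obtain r where "linear_order_on (D X) r" "{st_r \<phi> X} \<times> D X \<subseteq> r"
    using linear_order_with_top[OF assms(1)] by blast
  moreover have "value_pairs D \<phi> X \<subseteq> {st_r \<phi> X} \<times> D X"
    using True by (auto simp: value_pairs_def)
  ultimately show ?thesis using that by blast
next
  case False
  then have "st_s \<phi> X \<in> D X" using assms(2,3) by (auto simp: L_pqT_def PiE_iff)
  then obtain r where "linear_order_on (D X) r" "{st_s \<phi> X} \<times> D X \<subseteq> r"
    using linear_order_with_top[OF assms(1)] by blast
  moreover have "value_pairs D \<phi> X \<subseteq> D X \<times> {st_s \<phi> X}"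
    using False assms(3) by (auto simp: value_pairs_def)
  ultimately have "linear_order_on (D X) (r\<inverse>)" "value_pairs D \<phi> X \<subseteq> r\<inverse>"
    by auto
  then show ?thesis by (rule that)
qed

text \<open>A strict comparison is a weak one without equivalence. Hence strictness only adds a
  condition on the set of variables of the model: a decisive one for all pairs, a nontrivial one for
  some pair.\<close>

lemma sat_iff:
  assumes "\<forall>X \<in> V. D X \<noteq> {}" "\<phi> \<in> L_pqT V D" "is_lex_model V D \<pi>"
  shows "sat V D \<phi> \<pi> \<longleftrightarrow> conforms (value_pairs D \<phi>) \<pi> \<and>
    (st_symbol \<phi> = FullyStrict \<longrightarrow> model_vars \<pi> \<inter> (st_R \<phi> \<inter> st_S \<phi>) \<noteq> {}) \<and>
    (st_symbol \<phi> = WeaklyStrict \<longrightarrow> \<not> model_vars \<pi> \<subseteq> st_U \<phi> \<union> st_T \<phi>)"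
proof -
  let ?P = "value_pairs D \<phi>"
  have V: "model_vars \<pi> \<subseteq> V" using assms(3) by (rule model_vars_subset)
  have P: "?P X \<noteq> {}" "?P X \<subseteq> D X \<times> D X" if "X \<in> V" for X
    using value_pairs_nonempty[OF assms(2)] assms(1) that by (auto simp: value_pairs_def)
  have "model_vars \<pi> \<inter> decisive ?P = model_vars \<pi> \<inter> (st_R \<phi> \<inter> st_S \<phi>)"
    using V decisive_value_pairs_iff[OF assms(2)] assms(1) by blast
  moreover have "model_vars \<pi> \<inter> nontrivial ?P = model_vars \<pi> - (st_U \<phi> \<union> st_T \<phi>)"
    using V nontrivial_value_pairs_iff[OF assms(2)] assms(1) by blast
  ultimately show ?thesis
    using all_lex_ge_iff_conforms[of V ?P D, OF P assms(3)]
      all_not_lex_equiv_iff[of V ?P D, OF P V] ex_not_lex_equiv_iff[of V ?P D, OF P V]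
    unfolding sat_def stmt_pairs_eq_product[OF assms(2)] lex_gt_iff
    by (cases "st_symbol \<phi>") (simp_all, blast+)
qed

theorem theorem2:
  fixes V :: "'v set" and D :: "'v \<Rightarrow> 'd set" and \<phi> :: "('v, 'd) pref_stmt"
  assumes "finite V"
    and "\<And>X. X \<in> V \<Longrightarrow> finite (D X) \<and> D X \<noteq> {}"
    and "\<phi> \<in> L_pqT V D"
  shows "strongly_compositional V D (sat V D \<phi>) \<and>
    ((st_symbol \<phi> = FullyStrict \<longrightarrow> st_R \<phi> \<inter> st_S \<phi> \<noteq> {}) \<and>
     (st_symbol \<phi> = WeaklyStrict \<longrightarrow> st_R \<phi> \<union> st_S \<phi> \<noteq> {}) \<longrightarrow>
       (\<forall>\<pi>. is_lex_model V D \<pi> \<longrightarrow>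
         (sat_star V D (sat V D \<phi>) \<pi> \<longleftrightarrow> sat V D (nonstrict_version \<phi>) \<pi>))) \<and>
    (st_symbol \<phi> = NonStrict \<longrightarrow>
       compositional V D (neg_stmt (sat V D \<phi>)) \<and>
       (st_R \<phi> = st_S \<phi> \<longrightarrow>
          strongly_compositional V D (neg_stmt (sat V D \<phi>)) \<and>
          (st_S \<phi> \<noteq> {} \<or> st_U \<phi> \<union> st_T \<phi> \<noteq> V \<longrightarrow>
             (\<forall>\<pi>. is_lex_model V D \<pi> \<longrightarrow>
               (sat_star V D (neg_stmt (sat V D \<phi>)) \<pi> \<longleftrightarrow>
                  neg_stmt (sat V D \<phi>) \<pi> \<or> model_vars \<pi> \<inter> st_S \<phi> = {})))))"
proof -
  let ?P = "value_pairs D \<phi>"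
  have ne: "\<forall>X \<in> V. D X \<noteq> {}" and D: "\<And>X. X \<in> V \<Longrightarrow> D X \<noteq> {}"
    using assms(2) by simp_all
  have sub: "st_R \<phi> \<subseteq> V" "st_S \<phi> \<subseteq> V" "st_U \<phi> \<subseteq> V" "st_T \<phi> \<subseteq> V"
    and disj: "(st_U \<phi> \<union> st_T \<phi>) \<inter> (st_R \<phi> \<union> st_S \<phi>) = {}"
    using assms(3) by (auto simp: L_pqT_def)
  note sat = sat_iff[OF ne assms(3)]
  have "nonstrict_version \<phi> \<in> L_pqT V D" "value_pairs D (nonstrict_version \<phi>) = ?P"
    "st_symbol (nonstrict_version \<phi>) = NonStrict"
    using assms(3) by (auto simp: L_pqT_def nonstrict_version_def value_pairs_def fun_eq_iff)
  then have nonstrict: "sat V D (nonstrict_version \<phi>) \<pi> \<longleftrightarrow> conforms ?P \<pi>"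
    if "is_lex_model V D \<pi>" for \<pi>
    using sat_iff[OF ne _ that, of "nonstrict_version \<phi>"] by simp
  note comp = is_lex_model_lex_comp[of V D]
  \<comment> \<open>A satisfying extension conforms, and so does its prefix
    \<open>\<pi>\<close>.\<close>
  have star: "conforms ?P \<pi>" if "sat_star V D (sat V D \<phi>) \<pi>" for \<pi>
    using that sat by (auto simp: sat_star_def prefix_def conforms_append)
  have decisive: "model_vars \<pi> \<inter> decisive ?P = model_vars \<pi> \<inter> (st_R \<phi> \<inter> st_S \<phi>)"
    if "is_lex_model V D \<pi>" for \<pi>
    using decisive_value_pairs_iff[OF assms(3)] D model_vars_subset[OF that] by blast
  \<comment> \<open>The strictness conditions are inherited from \<open>\<pi>'\<close>, all of whose
    variables occur in the composition.\<close>
  have A: "strongly_compositional V D (sat V D \<phi>)"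
    unfolding strongly_compositional_def
  proof clarify
    fix \<pi> \<pi>'
    assume m: "is_lex_model V D \<pi>" "is_lex_model V D \<pi>'"
      and s: "sat_star V D (sat V D \<phi>) \<pi>" "sat V D \<phi> \<pi>'"
    show "sat V D \<phi> (lex_comp \<pi> \<pi>')"
      using conforms_lex_comp[OF star[OF s(1)], of \<pi>'] s(2)
      unfolding sat[OF m(2)] sat[OF comp[OF m]] model_vars_lex_comp by blast
  qed
  have B: "sat_star V D (sat V D \<phi>) \<pi> \<longleftrightarrow> sat V D (nonstrict_version \<phi>) \<pi>"
    if fs: "st_symbol \<phi> = FullyStrict \<Longrightarrow> st_R \<phi> \<inter> st_S \<phi> \<noteq> {}"
      and ws: "st_symbol \<phi> = WeaklyStrict \<Longrightarrow> st_R \<phi> \<union> st_S \<phi> \<noteq> {}"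
      and m: "is_lex_model V D \<pi>" for \<pi>
    unfolding nonstrict[OF m]
  proof
    assume r: "conforms ?P \<pi>"
    show "sat_star V D (sat V D \<phi>) \<pi>"
    proof (cases "sat V D \<phi> \<pi>")
      case True
      then show ?thesis using m by (auto simp: sat_star_def)
    next
      case False
      have "(st_symbol \<phi> = FullyStrict \<and> model_vars \<pi> \<inter> (st_R \<phi> \<inter> st_S \<phi>) = {}) \<or>
        (st_symbol \<phi> = WeaklyStrict \<and> model_vars \<pi> \<subseteq> st_U \<phi> \<union> st_T \<phi>)"
        using False r unfolding sat[OF m] by blast
      \<comment> \<open>Only strictness can be missing. Appending this \<open>X\<close>, with an
        order containing \<open>?P X\<close>, supplies it and preserves conformity.\<close>
      then obtain X where X: "X \<in> st_R \<phi> \<union> st_S \<phi>" "X \<notin> model_vars \<pi>"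
        "st_symbol \<phi> = FullyStrict \<longrightarrow> X \<in> st_R \<phi> \<inter> st_S \<phi>"
      proof (elim disjE conjE)
        assume "st_symbol \<phi> = FullyStrict" "model_vars \<pi> \<inter> (st_R \<phi> \<inter> st_S \<phi>) = {}"
        with fs that show thesis by blast
      next
        assume "st_symbol \<phi> = WeaklyStrict" "model_vars \<pi> \<subseteq> st_U \<phi> \<union> st_T \<phi>"
        with ws disj that show thesis by (metis disjoint_iff equals0I pref_symbol.distinct(6) subsetD)
      qed
      have XV: "X \<in> V" using X(1) sub by blast
      obtain q where q: "linear_order_on (D X) q" "?P X \<subseteq> q"
        using linear_order_above_value_pairs[OF _ assms(3) X(1)] assms(2)[OF XV] by blast
      have m': "is_lex_model V D (\<pi> @ [(X, q)])"
        using is_lex_model_snoc[OF m XV q(1) X(2)] .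
      have "sat V D \<phi> (\<pi> @ [(X, q)])"
        unfolding sat[OF m'] using conforms_snoc[OF r q(2)] X disj by auto
      with m' show ?thesis by (auto simp: sat_star_def)
    qed
  qed (rule star)
  have neg: "neg_stmt (sat V D \<phi>) \<pi> \<longleftrightarrow> \<not> conforms ?P \<pi>"
    if "st_symbol \<phi> = NonStrict" "is_lex_model V D \<pi>" for \<pi>
    using sat[OF that(2)] that(1) by (simp add: neg_stmt_def)
  \<comment> \<open>A failure of conformity in \<open>\<pi>\<close> persists in every model that
    begins with \<open>\<pi>\<close>.\<close>
  have C: "compositional V D (neg_stmt (sat V D \<phi>))" if ns: "st_symbol \<phi> = NonStrict"
    unfolding compositional_def
    using neg[OF ns] comp by (auto simp: lex_comp_def conforms_append)
  \<comment> \<open>For \<open>R = S\<close> the variables of \<open>S\<close> are the decisive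
    ones; if a conforming \<open>\<pi>\<close> contained one, all its extensions would
    conform.\<close>
  have undecided: "model_vars \<pi> \<inter> st_S \<phi> = {}"
    if "st_symbol \<phi> = NonStrict" "st_R \<phi> = st_S \<phi>" "is_lex_model V D \<pi>"
      "sat_star V D (neg_stmt (sat V D \<phi>)) \<pi>" "conforms ?P \<pi>" for \<pi>
    using that neg[OF that(1)] decisive[OF that(3)]
    by (auto simp: sat_star_def prefix_def conforms_append)
  \<comment> \<open>A variable outside \<open>U\<close>, \<open>T\<close> and \<open>R = S\<close>
    is unconstrained, so its factor is the whole square, which no order contains.\<close>
  have trivial: "model_vars \<pi> \<subseteq> st_U \<phi> \<union> st_T \<phi>"
    if RS: "st_R \<phi> = st_S \<phi>" and m: "is_lex_model V D \<pi>"
      and S: "model_vars \<pi> \<inter> st_S \<phi> = {}" and r: "conforms ?P \<pi>" for \<pi>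
  proof (rule subsetI, rule ccontr)
    fix X assume X: "X \<in> model_vars \<pi>" "X \<notin> st_U \<phi> \<union> st_T \<phi>"
    have XV: "X \<in> V" using X model_vars_subset[OF m] by blast
    obtain a where a: "a \<in> D X" using D[OF XV] by blast
    obtain b where b: "b \<in> D X" "b \<noteq> a" using two_values[OF assms(3) XV D[OF XV]] X by auto
    have "X \<notin> st_R \<phi> \<union> st_S \<phi>" using S RS X by blast
    then have "?P X = D X \<times> D X" using X by (auto simp: value_pairs_def)
    moreover have "model_vars \<pi> \<inter> decisive ?P = {}" using decisive[OF m] S by blast
    ultimately show False
      using conforms_not_whole_square[OF r m _ X(1) b(1) a b(2)] by blast
  qed
  have E: "strongly_compositional V D (neg_stmt (sat V D \<phi>))"
    if ns: "st_symbol \<phi> = NonStrict" and RS: "st_R \<phi> = st_S \<phi>"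
    unfolding strongly_compositional_def
  proof clarify
    fix \<pi> \<pi>'
    assume m: "is_lex_model V D \<pi>" "is_lex_model V D \<pi>'"
      and s: "sat_star V D (neg_stmt (sat V D \<phi>)) \<pi>" "neg_stmt (sat V D \<phi>) \<pi>'"
    \<comment> \<open>Then \<open>\<pi>\<close> conforms and has only variables in
      \<open>U \<union> T\<close>. Deleting these from \<open>\<pi>'\<close> does not hide a
      failure, so \<open>\<pi>'\<close> conforms too.\<close>
    have False if "conforms ?P (lex_comp \<pi> \<pi>')"
    proof -
      have r: "conforms ?P \<pi>" using that by (simp add: lex_comp_def conforms_append)
      have S: "model_vars \<pi> \<inter> st_S \<phi> = {}" using undecided[OF ns RS m(1) s(1) r] .
      have "conforms ?P (filter (\<lambda>p. fst p \<notin> model_vars \<pi>) \<pi>')"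
        using that decisive[OF m(1)] S by (auto simp: lex_comp_def conforms_append)
      then have "conforms ?P \<pi>'"
      proof (rule conforms_of_filter[OF _ m(2)])
        show "?P X \<subseteq> D X \<times> D X" for X by (rule value_pairs_subset)
        fix p assume "\<not> fst p \<notin> model_vars \<pi>"
        then show "fst p \<notin> nontrivial ?P"
          using trivial[OF RS m(1) S r] nontrivial_value_pairs_iff[OF assms(3)] D
            model_vars_subset[OF m(1)] by blast
      qed
      then show False using s(2) neg[OF ns m(2)] by blast
    qed
    then show "neg_stmt (sat V D \<phi>) (lex_comp \<pi> \<pi>')"
      using neg[OF ns comp[OF m]] by blast
  qed
  have F: "sat_star V D (neg_stmt (sat V D \<phi>)) \<pi> \<longleftrightarrow>
      neg_stmt (sat V D \<phi>) \<pi> \<or> model_vars \<pi> \<inter> st_S \<phi> = {}"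
    if ns: "st_symbol \<phi> = NonStrict" and RS: "st_R \<phi> = st_S \<phi>"
      and ne: "st_S \<phi> \<noteq> {} \<or> st_U \<phi> \<union> st_T \<phi> \<noteq> V" and m: "is_lex_model V D \<pi>" for \<pi>
  proof
    assume "sat_star V D (neg_stmt (sat V D \<phi>)) \<pi>"
    then show "neg_stmt (sat V D \<phi>) \<pi> \<or> model_vars \<pi> \<inter> st_S \<phi> = {}"
      using undecided[OF ns RS m] neg[OF ns m] by blast
  next
    assume *: "neg_stmt (sat V D \<phi>) \<pi> \<or> model_vars \<pi> \<inter> st_S \<phi> = {}"
    show "sat_star V D (neg_stmt (sat V D \<phi>)) \<pi>"
    proof (cases "conforms ?P \<pi>")
      case False
      then show ?thesis using m neg[OF ns m] by (auto simp: sat_star_def)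
    next
      case True
      then have S: "model_vars \<pi> \<inter> st_S \<phi> = {}" using * neg[OF ns m] by blast
      \<comment> \<open>If \<open>S\<close> is nonempty, any of its elements serves, being outside
        \<open>U \<union> T\<close>.\<close>
      obtain X where X: "X \<in> V" "X \<notin> st_U \<phi> \<union> st_T \<phi>"
        using ne sub disj by blast
      have Xn: "X \<notin> model_vars \<pi>" using trivial[OF RS m S True] X(2) by blast
      obtain a b where ab: "(a, b) \<in> ?P X" "a \<noteq> b"
        using nontrivial_value_pairs_iff[OF assms(3) X(1) D[OF X(1)]] X(2)
        by (auto simp: nontrivial_def)
      then have "a \<in> D X" "b \<in> D X" by (auto simp: value_pairs_def)
      \<comment> \<open>With \<open>b\<close> on top, \<open>q\<close> excludes the pair
        \<open>(a, b)\<close> of \<open>?P X\<close>. The scan does reach the appended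
        \<open>X\<close>, because \<open>\<pi>\<close> has no decisive variable.\<close>
      then obtain q where q: "linear_order_on (D X) q" "(b, a) \<in> q"
        using linear_order_with_top[of "D X" b] assms(2)[OF X(1)] by blast
      then have "\<not> ?P X \<subseteq> q" using ab linear_order_on_antisym[OF q(1)] by blast
      moreover have "model_vars \<pi> \<inter> decisive ?P = {}" using decisive[OF m] S by blast
      ultimately have "\<not> conforms ?P (\<pi> @ [(X, q)])" by (simp add: conforms_append)
      moreover have m': "is_lex_model V D (\<pi> @ [(X, q)])"
        using is_lex_model_snoc[OF m X(1) q(1) Xn] .
      ultimately show ?thesis using neg[OF ns m'] by (auto simp: sat_star_def)
    qed
  qed
  show ?thesis
    by (intro conjI impI allI A B C E F) (elim conjE, blast)+
qed

end
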